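(* Let $\mathcal{A}$ be an additive category. Then $\mathcal{A}$ is a Krull-Schmidt category if and only if $\mathcal{A}$ has split idempotents and the endomorphism ring $\operatorname{End}_{\mathcal{A}}(X)$ of every object $X$ of $\mathcal{A}$ is semi-perfect.
   Context: An additive category is a Krull-Schmidt category if every object decomposes into a finite direct sum (biproduct) of objects having local endomorphism rings. A non-zero ring is local if the sum of two non-units is again a non-unit. An additive category has split idempotents if for every idempotent endomorphism $\phi=\phi^2$ of an object $X$ there is a factorisation $X\xrightarrow{\pi}Y\xrightarrow{\iota}X$ of $\phi$ (that is, $\phi=\iota\pi$) with $\pi\iota=\mathrm{id}_Y$. A ring $\Lambda$ (associative with unit) is semi-perfect if it satisfies the following equivalent conditions: the category of finitely generated projective right $\Lambda$-modules is a Krull-Schmidt category; the right module $\Lambda$ is a direct sum $P_1\oplus\cdots\oplus P_r$ with each $P_i$ having a local endomorphism ring; every simple right $\Lambda$-module admits a projective cover; every finitely generated right $\Lambda$-module admits a projective cover. Here a projective cover of a module $M$ is an epimorphism $\phi\colon P\to M$ with $P$ projective such that any morphism $\alpha\colon P'\to P$ is an epimorphism whenever $\phi\alpha$ is an epimorphism. *)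

theory Defs
  imports "HOL-Algebra.AbelCoset"
begin

section \<open>Additive categories\<close>

text \<open>
  Morphism sets for different pairs of objects may overlap, so composition is indexed by the
  three objects involved: \<open>Comp C X Y Z g f\<close> is the composite of \<open>f : X \<rightarrow> Y\<close> and \<open>g : Y \<rightarrow> Z\<close>.
\<close>

record ('o, 'm) preadd_cat =
  Obj :: "'o set"
  Hom :: "'o \<Rightarrow> 'o \<Rightarrow> 'm set"
  Comp :: "'o \<Rightarrow> 'o \<Rightarrow> 'o \<Rightarrow> 'm \<Rightarrow> 'm \<Rightarrow> 'm"
  Ident :: "'o \<Rightarrow> 'm"
  HomAdd :: "'o \<Rightarrow> 'o \<Rightarrow> 'm \<Rightarrow> 'm \<Rightarrow> 'm"
  HomZero :: "'o \<Rightarrow> 'o \<Rightarrow> 'm"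

definition hom_group :: "('o, 'm) preadd_cat \<Rightarrow> 'o \<Rightarrow> 'o \<Rightarrow> 'm monoid" where
  "hom_group C X Y = \<lparr>carrier = Hom C X Y, mult = HomAdd C X Y, one = HomZero C X Y\<rparr>"

definition end_ring :: "('o, 'm) preadd_cat \<Rightarrow> 'o \<Rightarrow> 'm ring" where
  "end_ring C X =
     \<lparr>carrier = Hom C X X, mult = Comp C X X X, one = Ident C X,
      zero = HomZero C X X, add = HomAdd C X X\<rparr>"

locale preadditive_category =
  fixes C :: "('o, 'm) preadd_cat"
  assumes ident_closed: "X \<in> Obj C \<Longrightarrow> Ident C X \<in> Hom C X X"
    and comp_closed:
      "\<lbrakk>X \<in> Obj C; Y \<in> Obj C; Z \<in> Obj C; f \<in> Hom C X Y; g \<in> Hom C Y Z\<rbrakk>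
        \<Longrightarrow> Comp C X Y Z g f \<in> Hom C X Z"
    and comp_ident_right:
      "\<lbrakk>X \<in> Obj C; Y \<in> Obj C; f \<in> Hom C X Y\<rbrakk> \<Longrightarrow> Comp C X X Y f (Ident C X) = f"
    and comp_ident_left:
      "\<lbrakk>X \<in> Obj C; Y \<in> Obj C; f \<in> Hom C X Y\<rbrakk> \<Longrightarrow> Comp C X Y Y (Ident C Y) f = f"
    and comp_assoc:
      "\<lbrakk>W \<in> Obj C; X \<in> Obj C; Y \<in> Obj C; Z \<in> Obj C;
        f \<in> Hom C W X; g \<in> Hom C X Y; h \<in> Hom C Y Z\<rbrakk>
        \<Longrightarrow> Comp C W X Z (Comp C X Y Z h g) f = Comp C W Y Z h (Comp C W X Y g f)"
    and hom_comm_group: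
      "\<lbrakk>X \<in> Obj C; Y \<in> Obj C\<rbrakk> \<Longrightarrow> comm_group (hom_group C X Y)"
    and comp_add_right:
      "\<lbrakk>X \<in> Obj C; Y \<in> Obj C; Z \<in> Obj C;
        f \<in> Hom C X Y; f' \<in> Hom C X Y; g \<in> Hom C Y Z\<rbrakk>
        \<Longrightarrow> Comp C X Y Z g (HomAdd C X Y f f')
            = HomAdd C X Z (Comp C X Y Z g f) (Comp C X Y Z g f')"
    and comp_add_left:
      "\<lbrakk>X \<in> Obj C; Y \<in> Obj C; Z \<in> Obj C;
        f \<in> Hom C X Y; g \<in> Hom C Y Z; g' \<in> Hom C Y Z\<rbrakk>
        \<Longrightarrow> Comp C X Y Z (HomAdd C Y Z g g') f
            = HomAdd C X Z (Comp C X Y Z g f) (Comp C X Y Z g' f)"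

text \<open>
  \<open>X\<close> is the biproduct of \<open>Y 0, \<dots>, Y (n - 1)\<close> with injections \<open>i k\<close> and projections \<open>p k\<close>;
  for \<open>n = 0\<close> this says that the identity of \<open>X\<close> is zero, i.e. that \<open>X\<close> is a zero object.
\<close>

definition is_biproduct ::
  "('o, 'm) preadd_cat \<Rightarrow> nat \<Rightarrow> (nat \<Rightarrow> 'o) \<Rightarrow> 'o \<Rightarrow> (nat \<Rightarrow> 'm) \<Rightarrow> (nat \<Rightarrow> 'm) \<Rightarrow> bool" where
  "is_biproduct C n Y X i p \<longleftrightarrow>
     X \<in> Obj C \<and>
     (\<forall>k<n. Y k \<in> Obj C \<and> i k \<in> Hom C (Y k) X \<and> p k \<in> Hom C X (Y k)) \<and>
     (\<forall>j<n. \<forall>k<n. Comp C (Y k) X (Y j) (p j) (i k)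
        = (if j = k then Ident C (Y k) else HomZero C (Y k) (Y j))) \<and>
     finsum (end_ring C X) (\<lambda>k. Comp C X (Y k) X (i k) (p k)) {..<n} = Ident C X"

locale additive_category = preadditive_category +
  assumes finite_biproducts:
    "\<And>(n :: nat) Y. (\<forall>k<n. Y k \<in> Obj C) \<Longrightarrow> \<exists>X i p. is_biproduct C n Y X i p"

definition split_idempotents :: "('o, 'm) preadd_cat \<Rightarrow> bool" where
  "split_idempotents C \<longleftrightarrow>
     (\<forall>X \<in> Obj C. \<forall>\<phi> \<in> Hom C X X. Comp C X X X \<phi> \<phi> = \<phi> \<longrightarrow>
        (\<exists>Y \<in> Obj C. \<exists>\<pi> \<in> Hom C X Y. \<exists>\<iota> \<in> Hom C Y X.
           \<phi> = Comp C X Y X \<iota> \<pi> \<and> Comp C Y X Y \<pi> \<iota> = Ident C Y))"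

section \<open>Local rings and Krull-Schmidt categories\<close>

definition local_ring :: "('a, 'b) ring_scheme \<Rightarrow> bool" where
  "local_ring R \<longleftrightarrow>
     ring R \<and> carrier R \<noteq> {\<zero>\<^bsub>R\<^esub>} \<and>
     (\<forall>x \<in> carrier R - Units R. \<forall>y \<in> carrier R - Units R. x \<oplus>\<^bsub>R\<^esub> y \<notin> Units R)"

definition krull_schmidt :: "('o, 'm) preadd_cat \<Rightarrow> bool" where
  "krull_schmidt C \<longleftrightarrow>
     additive_category C \<and>
     (\<forall>X \<in> Obj C. \<exists>n Y i p. is_biproduct C n Y X i p \<and> (\<forall>k<n. local_ring (end_ring C (Y k))))"

section \<open>Right modules and semi-perfect rings\<close>

record ('a, 'b) rmod = "'b ring" +
  raction :: "'b \<Rightarrow> 'a \<Rightarrow> 'b"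

text \<open>The fields \<open>mult\<close> and \<open>one\<close> inherited from \<open>ring\<close> play no role.\<close>

locale right_module = R?: ring R + M?: abelian_group M
  for R :: "('a, 'c) ring_scheme" and M :: "('a, 'b, 'd) rmod_scheme" +
  assumes raction_closed:
      "\<lbrakk>x \<in> carrier M; a \<in> carrier R\<rbrakk> \<Longrightarrow> raction M x a \<in> carrier M"
    and raction_add_ring:
      "\<lbrakk>x \<in> carrier M; a \<in> carrier R; b \<in> carrier R\<rbrakk>
        \<Longrightarrow> raction M x (a \<oplus>\<^bsub>R\<^esub> b) = raction M x a \<oplus>\<^bsub>M\<^esub> raction M x b"
    and raction_add_module:
      "\<lbrakk>x \<in> carrier M; y \<in> carrier M; a \<in> carrier R\<rbrakk>
        \<Longrightarrow> raction M (x \<oplus>\<^bsub>M\<^esub> y) a = raction M x a \<oplus>\<^bsub>M\<^esub> raction M y a"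
    and raction_mult:
      "\<lbrakk>x \<in> carrier M; a \<in> carrier R; b \<in> carrier R\<rbrakk>
        \<Longrightarrow> raction M x (a \<otimes>\<^bsub>R\<^esub> b) = raction M (raction M x a) b"
    and raction_one: "x \<in> carrier M \<Longrightarrow> raction M x \<one>\<^bsub>R\<^esub> = x"

definition regular_rmod :: "('a, 'c) ring_scheme \<Rightarrow> ('a, 'a) rmod" where
  "regular_rmod R =
     \<lparr>carrier = carrier R, mult = mult R, one = one R, zero = zero R, add = add R,
      raction = mult R\<rparr>"

definition right_submodule ::
  "('a, 'c) ring_scheme \<Rightarrow> ('a, 'b, 'd) rmod_scheme \<Rightarrow> 'b set \<Rightarrow> bool" where
  "right_submodule R M N \<longleftrightarrow>
     additive_subgroup N M \<and> (\<forall>x \<in> N. \<forall>a \<in> carrier R. raction M x a \<in> N)"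

text \<open>The functions are extensional, so that each endomorphism has a unique representative.\<close>

definition rmod_endos ::
  "('a, 'c) ring_scheme \<Rightarrow> ('a, 'b, 'd) rmod_scheme \<Rightarrow> ('b \<Rightarrow> 'b) set" where
  "rmod_endos R M =
     {f \<in> carrier M \<rightarrow>\<^sub>E carrier M.
        (\<forall>x \<in> carrier M. \<forall>y \<in> carrier M. f (x \<oplus>\<^bsub>M\<^esub> y) = f x \<oplus>\<^bsub>M\<^esub> f y) \<and>
        (\<forall>x \<in> carrier M. \<forall>a \<in> carrier R. f (raction M x a) = raction M (f x) a)}"

definition rmod_end_ring ::
  "('a, 'c) ring_scheme \<Rightarrow> ('a, 'b, 'd) rmod_scheme \<Rightarrow> ('b \<Rightarrow> 'b) ring" where
  "rmod_end_ring R M =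
     \<lparr>carrier = rmod_endos R M,
      mult = compose (carrier M),
      one = (\<lambda>x \<in> carrier M. x),
      zero = (\<lambda>x \<in> carrier M. \<zero>\<^bsub>M\<^esub>),
      add = (\<lambda>f g. \<lambda>x \<in> carrier M. f x \<oplus>\<^bsub>M\<^esub> g x)\<rparr>"

text \<open>\<open>M\<close> is the internal direct sum of its submodules \<open>P 0, \<dots>, P (n - 1)\<close>.\<close>

definition rmod_direct_sum ::
  "('a, 'c) ring_scheme \<Rightarrow> ('a, 'b, 'd) rmod_scheme \<Rightarrow> nat \<Rightarrow> (nat \<Rightarrow> 'b set) \<Rightarrow> bool" where
  "rmod_direct_sum R M n P \<longleftrightarrow>
     (\<forall>k<n. right_submodule R M (P k)) \<and>
     (\<forall>x \<in> carrier M. \<exists>!y. y \<in> (\<Pi>\<^sub>E k\<in>{..<n}. P k) \<and> x = finsum M y {..<n})"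

text \<open>
  Of the standard equivalent characterisations of semi-perfect rings we take as definition that
  the right regular module is a finite direct sum of modules with local endomorphism rings.
\<close>

definition semi_perfect :: "('a, 'c) ring_scheme \<Rightarrow> bool" where
  "semi_perfect R \<longleftrightarrow>
     ring R \<and>
     (\<exists>n P. rmod_direct_sum R (regular_rmod R) n P \<and>
        (\<forall>k<n. local_ring (rmod_end_ring R ((regular_rmod R)\<lparr>carrier := P k\<rparr>))))"

section \<open>Basic facts\<close>

lemma (in preadditive_category) ring_end_ring:
  assumes X: "X \<in> Obj C"
  shows "ring (end_ring C X)"
proof -
  interpret G: comm_group "hom_group C X X" using hom_comm_group[OF X X] .
  have inv: "\<exists>y\<in>Hom C X X. HomAdd C X X y x = HomZero C X X" if "x \<in> Hom C X X" for x
    using that G.l_inv_ex[of x] by (auto simp: hom_group_def)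
  show ?thesis
  proof (rule ringI)
    show "abelian_group (end_ring C X)"
      by (rule abelian_groupI)
        (use G.m_closed G.one_closed G.m_assoc G.m_comm G.l_one inv in
          \<open>auto simp: end_ring_def hom_group_def\<close>)
    show "monoid (end_ring C X)"
      by (rule monoidI)
        (use X in \<open>auto simp: end_ring_def ident_closed comp_closed comp_assoc
            comp_ident_left comp_ident_right\<close>)
  qed (use X in \<open>auto simp: end_ring_def comp_add_left comp_add_right\<close>)
qed

lemma (in ring) right_module_regular: "right_module R (regular_rmod R)"
proof -
  have "abelian_group (regular_rmod R)"
    by (rule abelian_groupI)
      (auto simp: regular_rmod_def a_ac intro: bexI[of _ "\<ominus> x" for x] l_neg)
  then show ?thesis
    unfolding right_module_def right_module_axioms_def
    using ring_axioms by (auto simp: regular_rmod_def l_distr r_distr m_assoc)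
qed

lemma (in right_module) right_module_submodule:
  assumes N: "right_submodule R M N"
  shows "right_module R (M\<lparr>carrier := N\<rparr>)"
proof -
  interpret N: additive_subgroup N M using N by (simp add: right_submodule_def)
  have sub: "x \<in> carrier M" if "x \<in> N" for x using that N.a_subset by blast
  have "abelian_group (M\<lparr>carrier := N\<rparr>)"
  proof (rule abelian_groupI)
    fix x assume x: "x \<in> carrier (M\<lparr>carrier := N\<rparr>)"
    have "\<ominus>\<^bsub>M\<^esub> x \<in> N" using x N.a_inv_closed by simp
    then show "\<exists>y\<in>carrier (M\<lparr>carrier := N\<rparr>). y \<oplus>\<^bsub>M\<lparr>carrier := N\<rparr>\<^esub> x = \<zero>\<^bsub>M\<lparr>carrier := N\<rparr>\<^esub>"
      using x sub M.l_neg by (auto intro: bexI[of _ "\<ominus>\<^bsub>M\<^esub> x"])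
  qed (auto simp: sub M.a_ac)
  then show ?thesis
    unfolding right_module_def right_module_axioms_def
    using N R.ring_axioms sub
    by (auto simp: right_submodule_def raction_add_ring raction_add_module raction_mult raction_one)
qed

lemma rmod_endosD:
  assumes "f \<in> rmod_endos R M"
  shows "x \<in> carrier M \<Longrightarrow> f x \<in> carrier M"
    and "\<lbrakk>x \<in> carrier M; y \<in> carrier M\<rbrakk> \<Longrightarrow> f (x \<oplus>\<^bsub>M\<^esub> y) = f x \<oplus>\<^bsub>M\<^esub> f y"
    and "\<lbrakk>x \<in> carrier M; a \<in> carrier R\<rbrakk> \<Longrightarrow> f (raction M x a) = raction M (f x) a"
    and "restrict f (carrier M) = f"
  using assms by (auto simp: rmod_endos_def dest: PiE_mem PiE_restrict)

lemma restrict_in_rmod_endos: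
  assumes "\<And>x. x \<in> carrier M \<Longrightarrow> h x \<in> carrier M"
    and "\<And>x y. \<lbrakk>x \<in> carrier M; y \<in> carrier M; x \<oplus>\<^bsub>M\<^esub> y \<in> carrier M\<rbrakk> \<Longrightarrow> h (x \<oplus>\<^bsub>M\<^esub> y) = h x \<oplus>\<^bsub>M\<^esub> h y"
    and "\<And>x a. \<lbrakk>x \<in> carrier M; a \<in> carrier R\<rbrakk> \<Longrightarrow> h (raction M x a) = raction M (h x) a"
    and "right_module R M"
  shows "restrict h (carrier M) \<in> rmod_endos R M"
proof -
  interpret right_module R M by fact
  show ?thesis
    unfolding rmod_endos_def using assms(1-3) raction_closed by auto
qed

lemma (in right_module) raction_zero_left:
  assumes "a \<in> carrier R" shows "raction M \<zero>\<^bsub>M\<^esub> a = \<zero>\<^bsub>M\<^esub>"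
  using raction_add_module[of "\<zero>\<^bsub>M\<^esub>" "\<zero>\<^bsub>M\<^esub>" a] assms raction_closed[of "\<zero>\<^bsub>M\<^esub>" a]
  by (simp add: M.add.l_cancel_one')

lemma (in right_module) raction_minus_left:
  assumes x: "x \<in> carrier M" and a: "a \<in> carrier R"
  shows "raction M (\<ominus>\<^bsub>M\<^esub> x) a = \<ominus>\<^bsub>M\<^esub> raction M x a"
proof -
  have "raction M (\<ominus>\<^bsub>M\<^esub> x) a \<oplus>\<^bsub>M\<^esub> raction M x a = \<zero>\<^bsub>M\<^esub>"
    using raction_add_module[of "\<ominus>\<^bsub>M\<^esub> x" x a] x a raction_zero_left by (simp add: M.l_neg)
  then show ?thesis
    using M.minus_equality raction_closed x a by simp
qed

lemma (in right_module) ring_rmod_end_ring: "ring (rmod_end_ring R M)"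
proof -
  note rm = right_module_axioms
  let ?c = "carrier M"
  have add: "(\<lambda>x\<in>?c. f x \<oplus>\<^bsub>M\<^esub> g x) \<in> rmod_endos R M"
    if "f \<in> rmod_endos R M" "g \<in> rmod_endos R M" for f g
    by (rule restrict_in_rmod_endos[OF _ _ _ rm])
      (use that in \<open>simp_all add: rmod_endosD raction_add_module M.a_ac\<close>)
  have mult: "(\<lambda>x\<in>?c. f (g x)) \<in> rmod_endos R M"
    if "f \<in> rmod_endos R M" "g \<in> rmod_endos R M" for f g
    by (rule restrict_in_rmod_endos[OF _ _ _ rm]) (use that in \<open>simp_all add: rmod_endosD\<close>)
  have one: "(\<lambda>x\<in>?c. x) \<in> rmod_endos R M"
    by (rule restrict_in_rmod_endos[OF _ _ _ rm]) simp_all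
  have zero: "(\<lambda>x\<in>?c. \<zero>\<^bsub>M\<^esub>) \<in> rmod_endos R M"
    by (rule restrict_in_rmod_endos[OF _ _ _ rm]) (simp_all add: raction_zero_left)
  have minus: "(\<lambda>x\<in>?c. \<ominus>\<^bsub>M\<^esub> f x) \<in> rmod_endos R M" if "f \<in> rmod_endos R M" for f
    by (rule restrict_in_rmod_endos[OF _ _ _ rm])
      (use that in \<open>simp_all add: rmod_endosD raction_minus_left M.minus_add\<close>)
  have idl: "(\<lambda>x\<in>?c. h x) = f" if "f \<in> rmod_endos R M" "\<And>x. x \<in> ?c \<Longrightarrow> h x = f x" for f h
    using rmod_endosD(4)[OF that(1)] that(2) by (metis restrict_ext)
  show ?thesis
  proof (rule ringI)
    show "abelian_group (rmod_end_ring R M)"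
    proof (rule abelian_groupI)
      fix f assume f: "f \<in> carrier (rmod_end_ring R M)"
      show "\<exists>g\<in>carrier (rmod_end_ring R M).
          g \<oplus>\<^bsub>rmod_end_ring R M\<^esub> f = \<zero>\<^bsub>rmod_end_ring R M\<^esub>"
        by (rule bexI[of _ "\<lambda>x\<in>?c. \<ominus>\<^bsub>M\<^esub> f x"])
          (use f in \<open>simp_all add: rmod_end_ring_def minus rmod_endosD M.l_neg cong: restrict_cong\<close>)
      show "\<zero>\<^bsub>rmod_end_ring R M\<^esub> \<oplus>\<^bsub>rmod_end_ring R M\<^esub> f = f"
        using f by (simp add: rmod_end_ring_def) (rule idl, simp_all add: rmod_endosD)
    qed (simp_all add: rmod_end_ring_def add zero rmod_endosD M.a_ac cong: restrict_cong)
    show "monoid (rmod_end_ring R M)"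
    proof (rule monoidI)
      fix f assume f: "f \<in> carrier (rmod_end_ring R M)"
      show "\<one>\<^bsub>rmod_end_ring R M\<^esub> \<otimes>\<^bsub>rmod_end_ring R M\<^esub> f = f"
        using f by (simp add: rmod_end_ring_def compose_def) (rule idl, simp_all add: rmod_endosD)
      show "f \<otimes>\<^bsub>rmod_end_ring R M\<^esub> \<one>\<^bsub>rmod_end_ring R M\<^esub> = f"
        using f by (simp add: rmod_end_ring_def compose_def) (rule idl, simp_all add: rmod_endosD)
    qed (simp_all add: rmod_end_ring_def compose_def mult one rmod_endosD cong: restrict_cong)
  qed (simp_all add: rmod_end_ring_def compose_def rmod_endosD cong: restrict_cong)
qed

end

theory Submission
  imports Defs "HOL-Algebra.QuotRing"
begin

text \<open>
  Via \<open>P = e R\<close>, a decomposition of the right module \<open>R\<close> into modules with local endomorphism rings is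
  the same as a complete system of orthogonal idempotents \<open>e\<close> with local corner rings \<open>e R e\<close>; if
  \<open>R = End X\<close> and \<open>e\<close> splits through \<open>Y\<close>, then \<open>e R e\<close> is isomorphic to \<open>End Y\<close>. What remains is that
  idempotents split in a Krull-Schmidt category. The split idempotents of \<open>R\<close> contain \<open>0\<close> and are closed
  under orthogonal sums and under passing from \<open>x y\<close> to \<open>y x\<close>; an exchange argument, by induction along the
  system of idempotents, shows that any such class is the class of all idempotents.
\<close>

section \<open>Corner rings and complete systems of orthogonal idempotents\<close>

text \<open>For an idempotent \<open>e\<close> this is the ring e R e. Its elements are described as
  the fixed points of multiplication by \<open>e\<close> on either side, so that membership is a
  pair of equations usable as rewrite rules.\<close>

definition corner :: "('a, 'b) ring_scheme \<Rightarrow> 'a \<Rightarrow> ('a, 'b) ring_scheme" where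
  "corner R e = R\<lparr>carrier := {x \<in> carrier R. e \<otimes>\<^bsub>R\<^esub> x = x \<and> x \<otimes>\<^bsub>R\<^esub> e = x}, one := e\<rparr>"

text \<open>For \<open>n = 0\<close> the empty sum forces 1 = 0, matching the zero object as the
  empty biproduct.\<close>

definition idem_system :: "('a, 'b) ring_scheme \<Rightarrow> nat \<Rightarrow> (nat \<Rightarrow> 'a) \<Rightarrow> bool" where
  "idem_system R n e \<longleftrightarrow>
     (\<forall>k<n. e k \<in> carrier R) \<and>
     (\<forall>j<n. \<forall>k<n. e j \<otimes>\<^bsub>R\<^esub> e k = (if j = k then e k else \<zero>\<^bsub>R\<^esub>)) \<and>
     finsum R e {..<n} = \<one>\<^bsub>R\<^esub>"

lemma corner_simps [simp]:
  "x \<in> carrier (corner R e) \<longleftrightarrow> x \<in> carrier R \<and> e \<otimes>\<^bsub>R\<^esub> x = x \<and> x \<otimes>\<^bsub>R\<^esub> e = x"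
  "mult (corner R e) = mult R" "add (corner R e) = add R"
  "one (corner R e) = e" "zero (corner R e) = zero R"
  by (auto simp: corner_def)

lemma (in ring) ring_corner:
  assumes e: "e \<in> carrier R" "e \<otimes> e = e"
  shows "ring (corner R e)"
proof (rule ringI)
  show "abelian_group (corner R e)"
  proof (rule abelian_groupI)
    fix x assume "x \<in> carrier (corner R e)"
    then show "\<exists>y\<in>carrier (corner R e). y \<oplus>\<^bsub>corner R e\<^esub> x = \<zero>\<^bsub>corner R e\<^esub>"
      using e by (intro bexI[of _ "\<ominus> x"]) (auto simp: r_minus l_minus l_neg)
  qed (use e in \<open>auto simp: a_ac r_distr l_distr\<close>)
  show "monoid (corner R e)"
  proof (rule monoidI)
    fix x y assume "x \<in> carrier (corner R e)" "y \<in> carrier (corner R e)"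
    then show "x \<otimes>\<^bsub>corner R e\<^esub> y \<in> carrier (corner R e)"
      \<comment> \<open>The two membership equations reassociate in opposite directions: x y e to
        the right, then e x y to the left.\<close>
      using e by (simp add: m_assoc[of x y e]) (simp add: m_assoc[symmetric])
  qed (use e in \<open>auto simp: m_assoc\<close>)
qed (auto simp: l_distr r_distr)

text \<open>A bijective homomorphism preserves and reflects units, hence also the condition on sums
  of non-units. That \<open>S\<close> is a ring is asked separately because \<open>ring_iso\<close>
  says nothing about the zero of its target.\<close>

lemma local_ring_iso:
  assumes loc: "local_ring R" and S: "ring S" and h: "h \<in> ring_iso R S"
  shows "local_ring S"
proof -
  interpret R: ring R using loc by (simp add: local_ring_def)
  interpret S: ring S by fact
  have hom: "h \<in> ring_hom R S" and bij: "bij_betw h (carrier R) (carrier S)"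
    using h by (auto simp: ring_iso_def)
  interpret h: ring_hom_ring R S h
    using hom by unfold_locales
  have inj: "x \<in> carrier R \<Longrightarrow> y \<in> carrier R \<Longrightarrow> h x = h y \<longleftrightarrow> x = y" for x y
    using bij by (auto simp: bij_betw_def inj_on_def)
  have surj: "\<exists>x \<in> carrier R. z = h x" if "z \<in> carrier S" for z
    using bij that by (auto simp: bij_betw_def)
  have units: "h x \<in> Units S \<longleftrightarrow> x \<in> Units R" if x: "x \<in> carrier R" for x
  proof
    assume "x \<in> Units R"
    then obtain y where "y \<in> carrier R" "y \<otimes>\<^bsub>R\<^esub> x = \<one>\<^bsub>R\<^esub>" "x \<otimes>\<^bsub>R\<^esub> y = \<one>\<^bsub>R\<^esub>"
      by (auto simp: Units_def)
    then show "h x \<in> Units S"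
      using x unfolding Units_def by (auto intro!: bexI[of _ "h y"] simp flip: h.hom_mult)
  next
    assume "h x \<in> Units S"
    then obtain z where "z \<in> carrier S" "z \<otimes>\<^bsub>S\<^esub> h x = \<one>\<^bsub>S\<^esub>" "h x \<otimes>\<^bsub>S\<^esub> z = \<one>\<^bsub>S\<^esub>"
      by (auto simp: Units_def)
    moreover from this(1) obtain y where y: "y \<in> carrier R" "z = h y" using surj by blast
    ultimately have "y \<otimes>\<^bsub>R\<^esub> x = \<one>\<^bsub>R\<^esub>" "x \<otimes>\<^bsub>R\<^esub> y = \<one>\<^bsub>R\<^esub>"
      using x inj[of "y \<otimes>\<^bsub>R\<^esub> x" "\<one>\<^bsub>R\<^esub>"] inj[of "x \<otimes>\<^bsub>R\<^esub> y" "\<one>\<^bsub>R\<^esub>"] by simp_all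
    then show "x \<in> Units R"
      using x y(1) unfolding Units_def by auto
  qed
  obtain x where x: "x \<in> carrier R" "x \<noteq> \<zero>\<^bsub>R\<^esub>"
    using loc R.zero_closed unfolding local_ring_def by blast
  then have "h x \<in> carrier S" "h x \<noteq> \<zero>\<^bsub>S\<^esub>"
    using inj[of x "\<zero>\<^bsub>R\<^esub>"] by auto
  moreover have "z \<oplus>\<^bsub>S\<^esub> w \<notin> Units S"
    if zw: "z \<in> carrier S - Units S" "w \<in> carrier S - Units S" for z w
  proof -
    obtain x y where xy: "x \<in> carrier R" "y \<in> carrier R" "z = h x" "w = h y"
      using surj[of z] surj[of w] zw by auto
    then have "x \<in> carrier R - Units R" "y \<in> carrier R - Units R"
      using zw units by auto
    then have "x \<oplus>\<^bsub>R\<^esub> y \<notin> Units R"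
      using loc unfolding local_ring_def by blast
    then show ?thesis
      using xy units[of "x \<oplus>\<^bsub>R\<^esub> y"] by simp
  qed
  ultimately show ?thesis
    using S unfolding local_ring_def by blast
qed

lemma local_ring_iso_iff:
  assumes R: "ring R" and S: "ring S" and h: "h \<in> ring_iso R S"
  shows "local_ring R \<longleftrightarrow> local_ring S"
  using local_ring_iso[OF _ S h] local_ring_iso[OF _ R ring_iso_set_sym[OF R h]] by blast

text \<open>
  \<open>h\<close> and \<open>c\<close> are orthogonal idempotents and \<open>v\<close> is the inverse of \<open>c d c\<close> in the corner ring of \<open>c\<close>. Then
  \<open>f\<close> is the projection with image \<open>d c R\<close> along the kernel of \<open>c d\<close>, and \<open>d v\<close> is the projection with the
  same image along the kernel of \<open>c\<close>, so that \<open>f\<close> can be exchanged for \<open>c\<close> in \<open>h + c\<close>.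
\<close>
lemma (in ring) exchange:
  assumes car: "h \<in> carrier R" "c \<in> carrier R" "d \<in> carrier R" "v \<in> carrier R"
    and idem: "h \<otimes> h = h" "c \<otimes> c = c" "d \<otimes> d = d" "h \<otimes> c = \<zero>" "c \<otimes> h = \<zero>"
    and d: "d \<otimes> (h \<oplus> c) = d" "(h \<oplus> c) \<otimes> d = d"
    and v: "v \<otimes> c = v" "c \<otimes> v = v" "v \<otimes> (d \<otimes> c) = c" "c \<otimes> (d \<otimes> v) = c"
  defines "f \<equiv> d \<otimes> v \<otimes> d"
    and "x \<equiv> h \<oplus> c \<ominus> d \<otimes> v"
    and "y \<equiv> h \<ominus> d \<otimes> v \<otimes> d \<otimes> h"
  shows "f \<otimes> f = f" "d \<otimes> f = f" "f \<otimes> d = f"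
    "(d \<otimes> v) \<otimes> (c \<otimes> d) = f" "(c \<otimes> d) \<otimes> (d \<otimes> v) = c"
    "x \<otimes> y = h" "y \<otimes> x = h \<oplus> c \<ominus> f" "h \<otimes> x = x" "y \<otimes> h = y"
proof -
  \<comment> \<open>Products are normalised to nest to the right, so each relation s t = w is also
    needed with a tail z behind it.\<close>
  have assoc: "s \<otimes> (t \<otimes> z) = w \<otimes> z"
    if "s \<otimes> t = w" "s \<in> carrier R" "t \<in> carrier R" "z \<in> carrier R" for s t w z
    using that m_assoc by metis
  have vh: "v \<otimes> h = \<zero>"
    using m_assoc[of v c h] v idem car by simp
  have vdv: "v \<otimes> (d \<otimes> v) = v"
    using m_assoc[of v "d \<otimes> c" v] m_assoc[of d c v] v car by simp
  \<comment> \<open>Since \<open>d\<close> lies below \<open>h + c\<close>, a factor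
    \<open>h\<close> next to \<open>d\<close> can be traded for \<open>c\<close>.\<close>
  have dh: "d \<otimes> h = d \<ominus> d \<otimes> c" and hd: "h \<otimes> d = d \<ominus> c \<otimes> d"
    using d car by (metis add.inv_solve_right' minus_eq r_distr l_distr m_closed a_comm)+
  note A = assoc[OF idem(1)] assoc[OF idem(2)] assoc[OF idem(3)] assoc[OF idem(4)] assoc[OF idem(5)]
    assoc[OF v(1)] assoc[OF v(2)] assoc[OF vh] assoc[OF hd] 
  have vd: "v \<otimes> (d \<otimes> (v \<otimes> z)) = v \<otimes> z" if "z \<in> carrier R" for z
    using vdv that car by (metis m_assoc m_closed)
  have cdv: "c \<otimes> (d \<otimes> (v \<otimes> z)) = c \<otimes> z" if "z \<in> carrier R" for z
    using v(4) that car by (metis m_assoc m_closed)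
  note simps = minus_eq m_assoc l_distr r_distr l_minus r_minus minus_add minus_minus A vd cdv vdv vh v idem car
  show "f \<otimes> f = f" "d \<otimes> f = f" "f \<otimes> d = f"
    "(d \<otimes> v) \<otimes> (c \<otimes> d) = f" "(c \<otimes> d) \<otimes> (d \<otimes> v) = c"
    by (simp_all add: f_def simps)
  have hdv: "h \<otimes> (d \<otimes> v) = d \<otimes> v \<ominus> c"
    using hd car v by (simp add: simps)
  show "h \<otimes> x = x"
    using car by (simp add: x_def hdv simps a_ac)
  show "y \<otimes> h = y"
    by (simp add: y_def simps)
  \<comment> \<open>\<open>x\<close> is the projection onto h R along d v R, restricted to
    \<open>h + c\<close>, and \<open>y\<close> is \<open>(h + c - f) h\<close>: they are mutually
    inverse isomorphisms between the complement of \<open>f\<close> and h R.\<close>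
  show "x \<otimes> y = h"
    by (simp add: x_def y_def simps a_ac r_neg1 r_neg2 r_neg)
  show "y \<otimes> x = h \<oplus> c \<ominus> f"
    by (simp add: x_def y_def f_def simps dh a_ac r_neg1 r_neg2 r_neg)
qed

section \<open>Induction along a system of idempotents\<close>

text \<open>Both \<open>d\<close> and \<open>d' = g - d\<close> lie below \<open>g = h + c\<close>.
  Locality of c R c lets \<open>c\<close> be exchanged for a summand \<open>f\<close> of
  \<open>d\<close> or of \<open>d'\<close>, and the complement of \<open>f\<close> in
  \<open>g\<close> is then isomorphic to \<open>h\<close>. In the first case \<open>f\<close> is
  isomorphic to \<open>c\<close> and \<open>d - f\<close> lies in that complement; in the second
  case all of \<open>d\<close> does. What lies below \<open>h\<close> is covered by
  \<open>IH\<close>.\<close>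

lemma (in ring) idem_class_step:
  fixes S :: "'a \<Rightarrow> bool"
  assumes car: "h \<in> carrier R" "c \<in> carrier R" "d \<in> carrier R"
    and idem: "h \<otimes> h = h" "c \<otimes> c = c" "d \<otimes> d = d" "h \<otimes> c = \<zero>" "c \<otimes> h = \<zero>"
    and d: "d \<otimes> (h \<oplus> c) = d" "(h \<oplus> c) \<otimes> d = d"
    and loc: "local_ring (corner R c)"
    and Sc: "S c"
    and IH: "\<And>p. \<lbrakk>p \<in> carrier R; p \<otimes> p = p; h \<otimes> p = p; p \<otimes> h = p\<rbrakk> \<Longrightarrow> S p"
    and Siso: "\<And>x y. \<lbrakk>x \<in> carrier R; y \<in> carrier R; (x \<otimes> y) \<otimes> (x \<otimes> y) = x \<otimes> y;
      (y \<otimes> x) \<otimes> (y \<otimes> x) = y \<otimes> x; S (x \<otimes> y)\<rbrakk> \<Longrightarrow> S (y \<otimes> x)"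
    and Sadd: "\<And>p q. \<lbrakk>p \<in> carrier R; q \<in> carrier R; p \<otimes> p = p; q \<otimes> q = q;
      p \<otimes> q = \<zero>; q \<otimes> p = \<zero>; S p; S q\<rbrakk> \<Longrightarrow> S (p \<oplus> q)"
  shows "S d"
proof -
  define g where "g = h \<oplus> c"
  have g: "g \<in> carrier R" "g \<otimes> g = g" "c \<otimes> g = c" "g \<otimes> c = c" "d \<otimes> g = d" "g \<otimes> d = d"
    using car idem d by (simp_all add: g_def l_distr r_distr)
  \<comment> \<open>An idempotent \<open>p\<close> below \<open>g\<close> and orthogonal to
    \<open>f = b v b\<close> lies below \<open>g - f = y x\<close>. The maps \<open>x\<close> and
    \<open>y\<close> carry it to an idempotent \<open>q = x p y\<close> below \<open>h\<close>, and
    \<open>Siso\<close> brings \<open>S\<close> back from \<open>q\<close> to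
    \<open>p\<close>.\<close>
  have transport: "S p"
    if b: "b \<in> carrier R" "b \<otimes> b = b" "b \<otimes> g = b" "g \<otimes> b = b"
      and v: "v \<in> carrier R" "v \<otimes> c = v" "c \<otimes> v = v" "v \<otimes> (b \<otimes> c) = c" "c \<otimes> (b \<otimes> v) = c"
      and p: "p \<in> carrier R" "p \<otimes> p = p" "g \<otimes> p = p" "p \<otimes> g = p"
        "p \<otimes> (b \<otimes> v \<otimes> b) = \<zero>" "(b \<otimes> v \<otimes> b) \<otimes> p = \<zero>"
    for b v p
  proof -
    define f where "f = b \<otimes> v \<otimes> b"
    define x where "x = h \<oplus> c \<ominus> b \<otimes> v"
    define y where "y = h \<ominus> b \<otimes> v \<otimes> b \<otimes> h"
    note ex = exchange[OF car(1,2) b(1) v(1) idem(1,2) b(2) idem(4,5) b(3,4)[unfolded g_def] v(2-5),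
        folded f_def x_def y_def]
    have xy: "x \<in> carrier R" "y \<in> carrier R" and f: "f \<in> carrier R"
      using car b v by (simp_all add: x_def y_def f_def)
    have pyx: "p \<otimes> (y \<otimes> x) = p"
      using ex(7) p g f by (simp add: minus_eq r_distr r_minus flip: g_def f_def)
    \<comment> \<open>The doubled \<open>p\<close> presents \<open>q\<close> as the product of
      \<open>x p\<close> and \<open>p y\<close>, whose swapped product \<open>p y x p\<close> is
      \<open>p\<close>.\<close>
    define q where "q = x \<otimes> p \<otimes> (p \<otimes> y)"
    have "p \<otimes> (p \<otimes> y) = p \<otimes> y" using xy p by (metis m_assoc)
    then have q: "q = x \<otimes> p \<otimes> y" using xy p by (simp add: q_def m_assoc)
    have "q \<otimes> q = x \<otimes> (p \<otimes> (y \<otimes> x)) \<otimes> p \<otimes> y"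
      using xy p by (simp add: q m_assoc)
    also have "\<dots> = x \<otimes> (p \<otimes> p) \<otimes> y" using xy p(1) by (simp add: pyx) (simp add: m_assoc)
    finally have qq: "q \<otimes> q = q" by (simp add: q p(2))
    have qR: "q \<in> carrier R" using xy p by (simp add: q)
    have "S q"
      using xy p car ex(8,9) by (intro IH qR qq) (metis q m_assoc m_closed)+
    moreover have "(p \<otimes> y) \<otimes> (x \<otimes> p) = p"
      using xy p pyx by (metis m_assoc m_closed)
    ultimately show "S p"
      using Siso[of "x \<otimes> p" "p \<otimes> y"] xy p qq by (simp add: q_def)
  qed
  have cbc: "c \<otimes> b \<otimes> c \<in> carrier (corner R c)" if "b \<in> carrier R" for b
    using that car idem by (simp add: m_assoc) (simp flip: m_assoc add: idem)
  \<comment> \<open>The inverse \<open>v\<close> of \<open>c b c\<close> in the corner absorbs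
    \<open>c\<close> on both sides, which turns the inverse laws into the form that
    \<open>exchange\<close> expects.\<close>
  have unitE: "\<exists>v. v \<in> carrier R \<and> v \<otimes> c = v \<and> c \<otimes> v = v \<and> v \<otimes> (b \<otimes> c) = c \<and> c \<otimes> (b \<otimes> v) = c"
    if u: "c \<otimes> b \<otimes> c \<in> Units (corner R c)" and b: "b \<in> carrier R" for b
  proof -
    obtain v where v: "v \<in> carrier R" "c \<otimes> v = v" "v \<otimes> c = v"
      "v \<otimes> (c \<otimes> b \<otimes> c) = c" "(c \<otimes> b \<otimes> c) \<otimes> v = c"
      using u by (auto simp: Units_def)
    have "v \<otimes> (b \<otimes> c) = c" "c \<otimes> (b \<otimes> v) = c"
      using v b car by (metis m_assoc m_closed)+
    then show ?thesis using v by blast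
  qed
  define d' where "d' = g \<ominus> d"
  have d': "d' \<in> carrier R" "d' \<otimes> d' = d'" "d' \<otimes> g = d'" "g \<otimes> d' = d'"
      "d \<otimes> d' = \<zero>" "d' \<otimes> d = \<zero>"
    using car g idem by (simp_all add: d'_def minus_eq l_distr r_distr l_minus r_minus r_neg)
  \<comment> \<open>The identity \<open>c\<close> of the local corner is the sum of \<open>c d c\<close> and \<open>c d' c\<close>, so one of them is a unit.\<close>
  have "c \<otimes> d \<otimes> c \<oplus> c \<otimes> d' \<otimes> c = c \<otimes> (d \<oplus> d') \<otimes> c"
    using car d' by (simp add: l_distr r_distr)
  also have "d \<oplus> d' = g"
    using car g by (simp add: d'_def minus_eq a_lcomm[of d g] r_neg)
  finally have "c \<otimes> d \<otimes> c \<oplus>\<^bsub>corner R c\<^esub> c \<otimes> d' \<otimes> c = \<one>\<^bsub>corner R c\<^esub>"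
    using g idem by simp
  moreover have "\<one>\<^bsub>corner R c\<^esub> \<in> Units (corner R c)"
    using loc monoid.Units_one_closed[OF ring.is_monoid] unfolding local_ring_def by blast
  ultimately consider "c \<otimes> d \<otimes> c \<in> Units (corner R c)" | "c \<otimes> d' \<otimes> c \<in> Units (corner R c)"
    using loc cbc car d'(1) unfolding local_ring_def by (metis DiffI)
  then show ?thesis
  proof cases
    case 1
    obtain v where v: "v \<in> carrier R" "v \<otimes> c = v" "c \<otimes> v = v"
      "v \<otimes> (d \<otimes> c) = c" "c \<otimes> (d \<otimes> v) = c"
      using unitE[OF 1 car(3)] by blast
    define f where "f = d \<otimes> v \<otimes> d"
    note ex = exchange(1-5)[OF car v(1) idem d v(2-5), folded f_def]
    have f: "f \<in> carrier R" using car v by (simp add: f_def)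
    \<comment> \<open>\<open>f = (d v) (c d)\<close> and \<open>c = (c d) (d v)\<close>, so
      \<open>f\<close> inherits \<open>S\<close> from \<open>c\<close>.\<close>
    have "S f"
      using Siso[of "c \<otimes> d" "d \<otimes> v"] ex car v(1) idem Sc by simp
    define p where "p = d \<ominus> f"
    have fg: "f \<otimes> g = f" "g \<otimes> f = f"
      using ex f g car by (metis m_assoc)+
    have p: "p \<in> carrier R" "p \<otimes> p = p" "g \<otimes> p = p" "p \<otimes> g = p" "p \<otimes> f = \<zero>" "f \<otimes> p = \<zero>"
      using car f ex g fg idem by (simp_all add: p_def minus_eq l_distr r_distr l_minus r_minus r_neg)
    have "S p"
      by (rule transport[OF car(3) idem(3) g(5,6) v p(1-4)]) (use p in \<open>simp_all add: f_def\<close>)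
    then have "S (f \<oplus> p)" using Sadd \<open>S f\<close> f p ex by simp
    also have "f \<oplus> p = d" using f car by (simp add: p_def minus_eq a_lcomm[of f d] r_neg)
    finally show ?thesis .
  next
    case 2
    obtain v where v: "v \<in> carrier R" "v \<otimes> c = v" "c \<otimes> v = v"
      "v \<otimes> (d' \<otimes> c) = c" "c \<otimes> (d' \<otimes> v) = c"
      using unitE[OF 2 d'(1)] by blast
    \<comment> \<open>With \<open>b = d'\<close> the exchanged idempotent begins and ends with
      \<open>d'\<close>, hence is orthogonal to \<open>d\<close>, and \<open>d\<close> can be
      transported as a whole.\<close>
    show ?thesis
    proof (rule transport[OF d'(1-4) v car(3) idem(3) g(6,5)])
      show "d \<otimes> (d' \<otimes> v \<otimes> d') = \<zero>" using car d' v(1) by (simp flip: m_assoc)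
      show "d' \<otimes> v \<otimes> d' \<otimes> d = \<zero>" using car d' v(1) by (simp add: m_assoc)
    qed
  qed
qed

lemma (in ring) idem_system_orthogonal_finsum:
  assumes sys: "idem_system R n e" and m: "m < n"
  shows "e m \<otimes> finsum R e {..<m} = \<zero>" "finsum R e {..<m} \<otimes> e m = \<zero>"
proof -
  have e: "e \<in> {..<m} \<rightarrow> carrier R" "e m \<in> carrier R"
    using sys m by (auto simp: idem_system_def)
  have "e m \<otimes> e k = \<zero>" "e k \<otimes> e m = \<zero>" if "k < m" for k
    using sys m that by (auto simp: idem_system_def)
  then show "e m \<otimes> finsum R e {..<m} = \<zero>" "finsum R e {..<m} \<otimes> e m = \<zero>"
    using e finsum_cong'[of "{..<m}" "{..<m}" "\<lambda>_. \<zero>" "\<lambda>k. e m \<otimes> e k"]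
      finsum_cong'[of "{..<m}" "{..<m}" "\<lambda>_. \<zero>" "\<lambda>k. e k \<otimes> e m"]
    by (simp_all add: finsum_rdistr finsum_ldistr)
qed

text \<open>By induction on \<open>m\<close>, \<open>S\<close> holds for all idempotents below the
  sum of the \<open>e k\<close> with \<open>k < m\<close>; for \<open>m = n\<close> this sum is 1,
  and every idempotent lies below it. Idempotency of the partial sum is carried along because
  \<open>idem_class_step\<close> asks for it.\<close>

theorem (in ring) idem_class_all:
  fixes S :: "'a \<Rightarrow> bool"
  assumes sys: "idem_system R n e"
    and loc: "\<And>k. k < n \<Longrightarrow> local_ring (corner R (e k))"
    and S0: "S \<zero>" and Se: "\<And>k. k < n \<Longrightarrow> S (e k)"
    and Siso: "\<And>x y. \<lbrakk>x \<in> carrier R; y \<in> carrier R; (x \<otimes> y) \<otimes> (x \<otimes> y) = x \<otimes> y;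
      (y \<otimes> x) \<otimes> (y \<otimes> x) = y \<otimes> x; S (x \<otimes> y)\<rbrakk> \<Longrightarrow> S (y \<otimes> x)"
    and Sadd: "\<And>p q. \<lbrakk>p \<in> carrier R; q \<in> carrier R; p \<otimes> p = p; q \<otimes> q = q;
      p \<otimes> q = \<zero>; q \<otimes> p = \<zero>; S p; S q\<rbrakk> \<Longrightarrow> S (p \<oplus> q)"
    and d: "d \<in> carrier R" "d \<otimes> d = d"
  shows "S d"
proof -
  have "finsum R e {..<m} \<in> carrier R \<and> finsum R e {..<m} \<otimes> finsum R e {..<m} = finsum R e {..<m} \<and>
    (\<forall>p\<in>carrier R. p \<otimes> p = p \<longrightarrow> p \<otimes> finsum R e {..<m} = p \<longrightarrow> finsum R e {..<m} \<otimes> p = p \<longrightarrow> S p)"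
    if "m \<le> n" for m
    using that
  proof (induction m)
    \<comment> \<open>Only 0 lies below the empty sum, as \<open>p = p 0 = 0\<close>.\<close>
    case 0
    then show ?case using S0 by (auto dest: sym)
  next
    case (Suc m)
    then have m: "m < n" by simp
    define h where "h = finsum R e {..<m}"
    note IH = Suc.IH[OF less_imp_le[OF m], folded h_def]
    note orth = idem_system_orthogonal_finsum[OF sys m, folded h_def]
    have em: "e m \<in> carrier R" "e m \<otimes> e m = e m" using sys m by (auto simp: idem_system_def)
    have "e \<in> {..<m} \<rightarrow> carrier R" using sys m by (auto simp: idem_system_def)
    then have suc: "finsum R e {..<Suc m} = h \<oplus> e m"
      using em by (simp add: lessThan_Suc h_def finsum_insert a_comm)
    have "S p" if "p \<in> carrier R" "p \<otimes> p = p" "p \<otimes> (h \<oplus> e m) = p" "(h \<oplus> e m) \<otimes> p = p" for p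
      by (rule idem_class_step[of h "e m" p S]; (rule Siso Sadd; assumption)?)
        (use IH em orth that loc[OF m] Se[OF m] in auto)
    moreover have "(h \<oplus> e m) \<otimes> (h \<oplus> e m) = h \<oplus> e m"
      using IH em orth by (simp add: l_distr r_distr)
    ultimately show ?case using IH em by (simp add: suc)
  qed
  from this[of n] show ?thesis
    using sys d by (simp add: idem_system_def)
qed

section \<open>Semi-perfect rings\<close>

lemma regular_rmod_simps [simp]:
  "carrier (regular_rmod R) = carrier R" "add (regular_rmod R) = add R"
  "zero (regular_rmod R) = zero R" "raction (regular_rmod R) = mult R"
  by (simp_all add: regular_rmod_def)

text \<open>A finite sum depends only on carrier, zero and addition, which the two records
  share.\<close>

lemma finsum_regular_rmod [simp]: "finsum (regular_rmod R) = finsum R"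
  by (intro ext) (simp add: finsum_def finprod_def)

text \<open>For an idempotent \<open>e\<close> this set is the right ideal e R.\<close>

lemma (in ring) right_submodule_idem:
  assumes e: "e \<in> carrier R"
  shows "right_submodule R (regular_rmod R) {x \<in> carrier R. e \<otimes> x = x}"
proof -
  interpret M: right_module R "regular_rmod R" by (rule right_module_regular)
  \<comment> \<open>The two negations belong to different records; uniqueness of additive inverses
    identifies them.\<close>
  have inv: "\<ominus>\<^bsub>regular_rmod R\<^esub> x = \<ominus> x" if "x \<in> carrier R" for x
    using that by (intro M.M.minus_equality) (simp_all add: l_neg)
  have "subgroup {x \<in> carrier R. e \<otimes> x = x} (add_monoid (regular_rmod R))"
    by (rule M.M.add.subgroupI)
      (use e in \<open>auto simp: r_distr r_minus inv\<close>)
  then show ?thesis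
    using e by (simp add: right_submodule_def additive_subgroup_def flip: m_assoc)
qed

text \<open>An endomorphism of e R is left multiplication by its value at \<open>e\<close>, because
  \<open>f x = f (e x) = f e x\<close>; taking \<open>x = e\<close> puts \<open>f e\<close> into the
  corner. Endomorphisms of a right module act from the left, so composition becomes multiplication
  in the same order.\<close>

lemma (in ring) end_ring_idem_iso:
  assumes e: "e \<in> carrier R" "e \<otimes> e = e"
  defines "M \<equiv> (regular_rmod R)\<lparr>carrier := {x \<in> carrier R. e \<otimes> x = x}\<rparr>"
  shows "(\<lambda>f. f e) \<in> ring_iso (rmod_end_ring R M) (corner R e)"
proof -
  have M: "right_module R M"
    unfolding M_def
    by (rule right_module.right_module_submodule[OF right_module_regular right_submodule_idem[OF e(1)]])
  have M_simps [simp]: "x \<in> carrier M \<longleftrightarrow> x \<in> carrier R \<and> e \<otimes> x = x"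
    "add M = add R" "zero M = zero R" "raction M = mult R" for x
    by (auto simp: M_def)
  have endo: "f \<in> carrier (rmod_end_ring R M) \<longleftrightarrow> f \<in> rmod_endos R M" for f
    by (simp add: rmod_end_ring_def)
  have closed: "f x \<in> carrier R" "e \<otimes> f x = f x"
    if "f \<in> rmod_endos R M" "x \<in> carrier R" "e \<otimes> x = x" for f x
    using rmod_endosD(1)[OF that(1), of x] that by auto
  have eval: "f x = f e \<otimes> x" if "f \<in> rmod_endos R M" "x \<in> carrier R" "e \<otimes> x = x" for f x
    using rmod_endosD(3)[OF that(1), of e x] that e by simp
  have mem: "f e \<in> carrier (corner R e)" if "f \<in> rmod_endos R M" for f
    using closed[OF that, of e] eval[OF that, of e] e by simp
  have inv: "(\<lambda>x\<in>carrier M. r \<otimes> x) \<in> rmod_endos R M" if "r \<in> carrier (corner R e)" for r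
    by (rule restrict_in_rmod_endos[OF _ _ _ M])
      (use that e in \<open>auto simp: r_distr m_assoc\<close>, metis m_assoc)
  show ?thesis
  proof (rule ring_iso_memI)
    show "bij_betw (\<lambda>f. f e) (carrier (rmod_end_ring R M)) (carrier (corner R e))"
    proof (rule bij_betw_byWitness[where f' = "\<lambda>r. \<lambda>x\<in>carrier M. r \<otimes> x"])
      show "\<forall>f\<in>carrier (rmod_end_ring R M). (\<lambda>x\<in>carrier M. f e \<otimes> x) = f"
      proof
        fix f assume "f \<in> carrier (rmod_end_ring R M)"
        then have f: "f \<in> rmod_endos R M" by (simp add: endo)
        have "(\<lambda>x\<in>carrier M. f e \<otimes> x) = restrict f (carrier M)"
          using eval[OF f] by (intro restrict_ext) simp
        then show "(\<lambda>x\<in>carrier M. f e \<otimes> x) = f" using rmod_endosD(4)[OF f] by simp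
      qed
      show "\<forall>r\<in>carrier (corner R e). (\<lambda>x\<in>carrier M. r \<otimes> x) e = r"
        using e by simp
    qed (use mem inv endo in blast)+
    fix f g assume "f \<in> carrier (rmod_end_ring R M)" "g \<in> carrier (rmod_end_ring R M)"
    then have fg: "f \<in> rmod_endos R M" "g \<in> rmod_endos R M" by (simp_all add: endo)
    show "(f \<otimes>\<^bsub>rmod_end_ring R M\<^esub> g) e = f e \<otimes>\<^bsub>corner R e\<^esub> g e"
      using eval[OF fg(1), of "g e"] closed[OF fg(2)] e by (simp add: rmod_end_ring_def compose_def)
    show "(f \<oplus>\<^bsub>rmod_end_ring R M\<^esub> g) e = f e \<oplus>\<^bsub>corner R e\<^esub> g e"
      using e by (simp add: rmod_end_ring_def)
  qed (use mem endo e in \<open>auto simp: rmod_end_ring_def\<close>)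
qed

lemma (in ring) local_ring_end_ring_idem_iff:
  assumes e: "e \<in> carrier R" "e \<otimes> e = e"
  shows "local_ring (rmod_end_ring R ((regular_rmod R)\<lparr>carrier := {x \<in> carrier R. e \<otimes> x = x}\<rparr>))
    \<longleftrightarrow> local_ring (corner R e)"
  by (intro local_ring_iso_iff[OF _ ring_corner[OF e] end_ring_idem_iso[OF e]]
      right_module.ring_rmod_end_ring
      right_module.right_module_submodule[OF right_module_regular right_submodule_idem[OF e(1)]])

text \<open>The components of \<open>x\<close> are the \<open>e k x\<close>, which add up to
  \<open>1 x\<close>. Multiplying any decomposition of \<open>x\<close> by \<open>e j\<close> from
  the left isolates its component at \<open>j\<close>, whence uniqueness.\<close>

lemma (in ring) direct_sum_of_idem_system:
  assumes sys: "idem_system R n e"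
  shows "rmod_direct_sum R (regular_rmod R) n (\<lambda>k. {x \<in> carrier R. e k \<otimes> x = x})"
proof -
  have e: "e k \<in> carrier R" "e j \<otimes> e k = (if j = k then e k else \<zero>)" if "j < n" "k < n" for j k
    using sys that by (auto simp: idem_system_def)
  have sum: "finsum R e {..<n} = \<one>" using sys by (simp add: idem_system_def)
  have "\<exists>!y. y \<in> (\<Pi>\<^sub>E k\<in>{..<n}. {x \<in> carrier R. e k \<otimes> x = x}) \<and> x = finsum R y {..<n}"
    if x: "x \<in> carrier R" for x
  \<comment> \<open>Families of components are extensional, hence the restriction to indices below
    \<open>n\<close>.\<close>
  proof (rule ex1I[of _ "\<lambda>k\<in>{..<n}. e k \<otimes> x"])
    have "x = finsum R e {..<n} \<otimes> x" using x sum by simp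
    also have "\<dots> = finsum R (\<lambda>k. e k \<otimes> x) {..<n}"
      using e x by (intro finsum_ldistr) auto
    also have "\<dots> = finsum R (\<lambda>k\<in>{..<n}. e k \<otimes> x) {..<n}"
      using e x by (intro finsum_cong') auto
    finally show "(\<lambda>k\<in>{..<n}. e k \<otimes> x) \<in> (\<Pi>\<^sub>E k\<in>{..<n}. {x \<in> carrier R. e k \<otimes> x = x}) \<and>
        x = finsum R (\<lambda>k\<in>{..<n}. e k \<otimes> x) {..<n}"
      using e x by (auto simp flip: m_assoc)
  next
    fix y assume y: "y \<in> (\<Pi>\<^sub>E k\<in>{..<n}. {x \<in> carrier R. e k \<otimes> x = x}) \<and> x = finsum R y {..<n}"
    then have yR: "y k \<in> carrier R" "e k \<otimes> y k = y k" if "k < n" for k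
      using that by auto
    have "y j = e j \<otimes> x" if j: "j < n" for j
    proof -
      have "e j \<otimes> x = finsum R (\<lambda>k. e j \<otimes> y k) {..<n}"
        using y e j yR by (auto simp: finsum_rdistr)
      also have "\<dots> = finsum R (\<lambda>k. if j = k then y k else \<zero>) {..<n}"
      proof (intro finsum_cong')
        fix k assume "k \<in> {..<n}"
        then show "e j \<otimes> y k = (if j = k then y k else \<zero>)"
          using yR e j m_assoc[of "e j" "e k" "y k"] by auto
      qed (use yR in auto)
      also have "\<dots> = y j" using j yR by (intro finsum_singleton) auto
      finally show ?thesis by simp
    qed
    then show "y = (\<lambda>k\<in>{..<n}. e k \<otimes> x)"
      using y by (intro extensionalityI[of _ "{..<n}"]) (auto simp: PiE_def)
  qed
  then show ?thesis
    using right_submodule_idem e unfolding rmod_direct_sum_def by simp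
qed

text \<open>The \<open>e k\<close> are the components of 1.\<close>

lemma (in ring) idem_system_of_direct_sum:
  assumes P: "rmod_direct_sum R (regular_rmod R) n P"
  obtains e where "idem_system R n e" "\<And>k. k < n \<Longrightarrow> P k = {x \<in> carrier R. e k \<otimes> x = x}"
proof -
  have sub: "right_submodule R (regular_rmod R) (P k)" if "k < n" for k
    using P that by (auto simp: rmod_direct_sum_def)
  have zero: "\<zero> \<in> P k" and PR: "P k \<subseteq> carrier R"
    and act: "\<And>x a. x \<in> P k \<Longrightarrow> a \<in> carrier R \<Longrightarrow> x \<otimes> a \<in> P k" if "k < n" for k
    using sub[OF that] additive_subgroup.zero_closed[of "P k" "regular_rmod R"]
      additive_subgroup.a_subset[of "P k" "regular_rmod R"]
    by (auto simp: right_submodule_def)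
  have uniq: "y = z" if "y \<in> (\<Pi>\<^sub>E k\<in>{..<n}. P k)" "z \<in> (\<Pi>\<^sub>E k\<in>{..<n}. P k)"
    "finsum R y {..<n} = x" "finsum R z {..<n} = x" "x \<in> carrier R" for x y z
    using P that by (auto simp: rmod_direct_sum_def)
  obtain e where e: "e \<in> (\<Pi>\<^sub>E k\<in>{..<n}. P k)" "\<one> = finsum R e {..<n}"
    using P unfolding rmod_direct_sum_def by (metis finsum_regular_rmod one_closed regular_rmod_simps(1))
  have eP: "e k \<in> P k" and eR: "e k \<in> carrier R" if "k < n" for k
    using e(1) PR[OF that] that by auto
  \<comment> \<open>Both the family \<open>e k x\<close> and the family with \<open>x\<close> at
    \<open>j\<close> and 0 elsewhere decompose \<open>x\<close>, so they agree. For
    \<open>x = e j\<close> this is orthogonality.\<close>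
  have key: "e k \<otimes> x = (if k = j then x else \<zero>)" if j: "j < n" "x \<in> P j" and k: "k < n" for j k x
  proof -
    have x: "x \<in> carrier R" using PR j by auto
    have "(\<lambda>k\<in>{..<n}. e k \<otimes> x) = (\<lambda>k\<in>{..<n}. if k = j then x else \<zero>)"
    proof (rule uniq)
      have "finsum R (\<lambda>k\<in>{..<n}. e k \<otimes> x) {..<n} = finsum R (\<lambda>k. e k \<otimes> x) {..<n}"
        using eR x by (intro finsum_cong') auto
      also have "\<dots> = \<one> \<otimes> x" unfolding e(2) using eR x by (subst finsum_ldistr) auto
      also have "\<dots> = x" using x by simp
      finally show "finsum R (\<lambda>k\<in>{..<n}. e k \<otimes> x) {..<n} = x" .
      have "finsum R (\<lambda>k\<in>{..<n}. if k = j then x else \<zero>) {..<n}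
          = finsum R (\<lambda>k. if j = k then x else \<zero>) {..<n}"
        using x by (intro finsum_cong') auto
      also have "\<dots> = x" using j x by (intro finsum_singleton) auto
      finally show "finsum R (\<lambda>k\<in>{..<n}. if k = j then x else \<zero>) {..<n} = x" .
    qed (use x eP act zero j in auto)
    from fun_cong[OF this, of k] show ?thesis using k by simp
  qed
  show ?thesis
  proof
    show "idem_system R n e"
      using key eP eR e(2) by (auto simp: idem_system_def)
    show "P k = {x \<in> carrier R. e k \<otimes> x = x}" if "k < n" for k
      using key[OF that _ that] PR[OF that] act[OF that eP[OF that]] by force
  qed
qed

text \<open>This removes modules from the argument: afterwards semi-perfectness enters only through
  idempotents and their corners.\<close>

theorem (in ring) semi_perfect_iff:
  "semi_perfect R \<longleftrightarrow> (\<exists>n e. idem_system R n e \<and> (\<forall>k<n. local_ring (corner R (e k))))"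
proof
  assume "semi_perfect R"
  then obtain n P where P: "rmod_direct_sum R (regular_rmod R) n P"
    "\<forall>k<n. local_ring (rmod_end_ring R ((regular_rmod R)\<lparr>carrier := P k\<rparr>))"
    by (auto simp: semi_perfect_def)
  obtain e where e: "idem_system R n e" "\<And>k. k < n \<Longrightarrow> P k = {x \<in> carrier R. e k \<otimes> x = x}"
    using idem_system_of_direct_sum[OF P(1)] by blast
  then have "local_ring (corner R (e k))" if "k < n" for k
    using P(2) that local_ring_end_ring_idem_iff[of "e k"] by (auto simp: idem_system_def)
  then show "\<exists>n e. idem_system R n e \<and> (\<forall>k<n. local_ring (corner R (e k)))"
    using e(1) by blast
next
  assume "\<exists>n e. idem_system R n e \<and> (\<forall>k<n. local_ring (corner R (e k)))"
  then obtain n e where e: "idem_system R n e" "\<forall>k<n. local_ring (corner R (e k))" by blast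
  then have "\<forall>k<n. local_ring (rmod_end_ring R
      ((regular_rmod R)\<lparr>carrier := {x \<in> carrier R. e k \<otimes> x = x}\<rparr>))"
    using local_ring_end_ring_idem_iff by (auto simp: idem_system_def)
  then show "semi_perfect R"
    using direct_sum_of_idem_system[OF e(1)] ring_axioms unfolding semi_perfect_def by blast
qed

section \<open>Splitting idempotents in additive categories\<close>

text \<open>The condition of \<open>split_idempotents\<close> for a single morphism, so that
  \<open>splits C X\<close> can serve as the class \<open>S\<close> in
  \<open>idem_class_all\<close>.\<close>

definition splits :: "('o, 'm) preadd_cat \<Rightarrow> 'o \<Rightarrow> 'm \<Rightarrow> bool" where
  "splits C X \<phi> \<longleftrightarrow> (\<exists>Y \<in> Obj C. \<exists>\<pi> \<in> Hom C X Y. \<exists>\<iota> \<in> Hom C Y X.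
     \<phi> = Comp C X Y X \<iota> \<pi> \<and> Comp C Y X Y \<pi> \<iota> = Ident C Y)"

lemma end_ring_simps [simp]:
  "carrier (end_ring C X) = Hom C X X" "mult (end_ring C X) = Comp C X X X"
  "one (end_ring C X) = Ident C X" "zero (end_ring C X) = HomZero C X X"
  "add (end_ring C X) = HomAdd C X X"
  by (simp_all add: end_ring_def)

context preadditive_category
begin

section \<open>Zero morphisms and composition\<close>

lemma hom_add_zero:
  assumes "X \<in> Obj C" "Y \<in> Obj C"
  shows "HomZero C X Y \<in> Hom C X Y"
    and "f \<in> Hom C X Y \<Longrightarrow> HomAdd C X Y (HomZero C X Y) f = f"
    and "f \<in> Hom C X Y \<Longrightarrow> HomAdd C X Y f (HomZero C X Y) = f"
    and "f \<in> Hom C X Y \<Longrightarrow> g \<in> Hom C X Y \<Longrightarrow> HomAdd C X Y f g \<in> Hom C X Y"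
    and "f \<in> Hom C X Y \<Longrightarrow> HomAdd C X Y f f = f \<Longrightarrow> f = HomZero C X Y"
proof -
  interpret G: comm_group "hom_group C X Y" using hom_comm_group[OF assms] .
  show "HomZero C X Y \<in> Hom C X Y"
    "f \<in> Hom C X Y \<Longrightarrow> HomAdd C X Y (HomZero C X Y) f = f"
    "f \<in> Hom C X Y \<Longrightarrow> HomAdd C X Y f (HomZero C X Y) = f"
    "f \<in> Hom C X Y \<Longrightarrow> g \<in> Hom C X Y \<Longrightarrow> HomAdd C X Y f g \<in> Hom C X Y"
    "f \<in> Hom C X Y \<Longrightarrow> HomAdd C X Y f f = f \<Longrightarrow> f = HomZero C X Y"
    using G.one_closed G.l_one[of f] G.r_one[of f] G.m_closed[of f g] G.l_cancel_one[of f f]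
    by (auto simp: hom_group_def)
qed

text \<open>Since 0 + 0 = 0, the composite is equal to its own double, and cancellation in the Hom
  group makes it zero.\<close>

lemma comp_zero_right:
  assumes "X \<in> Obj C" "Y \<in> Obj C" "Z \<in> Obj C" "g \<in> Hom C Y Z"
  shows "Comp C X Y Z g (HomZero C X Y) = HomZero C X Z"
proof (rule hom_add_zero(5)[OF assms(1,3)])
  have zero: "HomZero C X Y \<in> Hom C X Y" by (rule hom_add_zero(1)[OF assms(1,2)])
  then show "Comp C X Y Z g (HomZero C X Y) \<in> Hom C X Z"
    using assms by (simp add: comp_closed)
  show "HomAdd C X Z (Comp C X Y Z g (HomZero C X Y)) (Comp C X Y Z g (HomZero C X Y))
      = Comp C X Y Z g (HomZero C X Y)"
    using zero by (simp add: hom_add_zero(2)[OF assms(1,2)]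
        flip: comp_add_right[OF assms(1-3) _ _ assms(4)])
qed

lemma comp_zero_left:
  assumes "X \<in> Obj C" "Y \<in> Obj C" "Z \<in> Obj C" "f \<in> Hom C X Y"
  shows "Comp C X Y Z (HomZero C Y Z) f = HomZero C X Z"
proof (rule hom_add_zero(5)[OF assms(1,3)])
  have zero: "HomZero C Y Z \<in> Hom C Y Z" by (rule hom_add_zero(1)[OF assms(2,3)])
  then show "Comp C X Y Z (HomZero C Y Z) f \<in> Hom C X Z"
    using assms by (simp add: comp_closed)
  show "HomAdd C X Z (Comp C X Y Z (HomZero C Y Z) f) (Comp C X Y Z (HomZero C Y Z) f)
      = Comp C X Y Z (HomZero C Y Z) f"
    using zero by (simp add: hom_add_zero(2)[OF assms(2,3)] flip: comp_add_left[OF assms(1-4)])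
qed

lemmas comp_simps = comp_closed comp_assoc comp_ident_left comp_ident_right comp_add_left
  comp_add_right comp_zero_left comp_zero_right hom_add_zero(1-4) ident_closed

text \<open>\<open>comp_simps\<close> nests composites to the right, where a relation
  \<open>p i = r\<close> is met with a further morphism \<open>f\<close> behind it.\<close>

lemma comp_cancel:
  assumes "Comp C X Y Z p i = r" "W \<in> Obj C" "X \<in> Obj C" "Y \<in> Obj C" "Z \<in> Obj C"
    "f \<in> Hom C W X" "i \<in> Hom C X Y" "p \<in> Hom C Y Z"
  shows "Comp C W Y Z p (Comp C W X Y i f) = Comp C W X Z r f"
  using comp_assoc[OF assms(2-8)] assms(1) by simp

section \<open>Corner rings of endomorphism rings\<close>

text \<open>Because \<open>p i\<close> is the identity, \<open>i r p\<close> is multiplicative in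
  \<open>r\<close> and its inverse is given by \<open>p s i\<close>; an element \<open>s\<close> of
  the corner is fixed by \<open>i p\<close> on both sides.\<close>

lemma corner_end_ring_iso:
  assumes obj: "X \<in> Obj C" "Y \<in> Obj C" and hom: "i \<in> Hom C Y X" "p \<in> Hom C X Y"
    and pi: "Comp C Y X Y p i = Ident C Y"
  shows "(\<lambda>r. Comp C X Y X i (Comp C X Y Y r p))
    \<in> ring_iso (end_ring C Y) (corner (end_ring C X) (Comp C X Y X i p))"
proof (rule ring_iso_memI)
  note [simp] = obj hom comp_simps pi comp_cancel[OF pi]
  show "bij_betw (\<lambda>r. Comp C X Y X i (Comp C X Y Y r p)) (carrier (end_ring C Y))
      (carrier (corner (end_ring C X) (Comp C X Y X i p)))"
    by (rule bij_betw_byWitness[where f' = "\<lambda>s. Comp C Y X Y p (Comp C Y X X s i)"]) auto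
qed (use obj hom in \<open>simp_all add: comp_simps pi comp_cancel[OF pi]\<close>)

lemma local_ring_corner_end_ring_iff:
  assumes obj: "X \<in> Obj C" "Y \<in> Obj C" and hom: "i \<in> Hom C Y X" "p \<in> Hom C X Y"
    and pi: "Comp C Y X Y p i = Ident C Y"
  shows "local_ring (corner (end_ring C X) (Comp C X Y X i p)) \<longleftrightarrow> local_ring (end_ring C Y)"
proof -
  have "ring (corner (end_ring C X) (Comp C X Y X i p))"
    using obj hom
    by (intro ring.ring_corner[OF ring_end_ring]) (simp_all add: comp_simps pi comp_cancel[OF pi])
  then show ?thesis
    using local_ring_iso_iff[OF ring_end_ring[OF obj(2)] _ corner_end_ring_iso[OF assms]] by simp
qed

section \<open>Closure properties of split idempotents\<close>

text \<open>If \<open>x y\<close> is \<iota> \<pi>, then \<open>y x = y (x y) x\<close> factors as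
  (y \<iota>) (\<pi> x), and the reverse composite is \<pi> (x y) \<iota> = (\<pi> \<iota>) (\<pi>
  \<iota>), the identity.\<close>

lemma splits_swap:
  assumes X: "X \<in> Obj C" and hom: "x \<in> Hom C X X" "y \<in> Hom C X X"
    and idem: "Comp C X X X (Comp C X X X y x) (Comp C X X X y x) = Comp C X X X y x"
    and xy: "splits C X (Comp C X X X x y)"
  shows "splits C X (Comp C X X X y x)"
proof -
  obtain Z \<pi> \<iota> where Z: "Z \<in> Obj C" "\<pi> \<in> Hom C X Z" "\<iota> \<in> Hom C Z X"
    and eq: "Comp C X X X x y = Comp C X Z X \<iota> \<pi>" and one: "Comp C Z X Z \<pi> \<iota> = Ident C Z"
    using xy unfolding splits_def by blast
  note simps = X Z hom comp_simps
  have "Comp C X X X y x = Comp C X X X y (Comp C X X X (Comp C X X X x y) x)"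
    using idem by (simp add: simps)
  also have "\<dots> = Comp C X Z X (Comp C Z X X y \<iota>) (Comp C X X Z \<pi> x)"
    unfolding eq by (simp add: simps)
  finally have 1: "Comp C X X X y x = Comp C X Z X (Comp C Z X X y \<iota>) (Comp C X X Z \<pi> x)" .
  have "Comp C Z X Z (Comp C X X Z \<pi> x) (Comp C Z X X y \<iota>)
      = Comp C Z X Z \<pi> (Comp C Z X X (Comp C X X X x y) \<iota>)"
    by (simp add: simps)
  also have "\<dots> = Ident C Z"
    unfolding eq by (simp add: simps one)
  finally show ?thesis
    unfolding splits_def using 1 X Z hom by (meson comp_closed)
qed

end

context additive_category
begin

text \<open>The empty biproduct \<open>W\<close> is a zero object, through which the zero morphism
  factors. The constant family only fills the type of the empty family.\<close>

lemma splits_zero: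
  assumes X: "X \<in> Obj C"
  shows "splits C X (HomZero C X X)"
proof -
  obtain W i p where "is_biproduct C 0 (\<lambda>_. X) W i p"
    using finite_biproducts[of 0 "\<lambda>_. X"] by auto
  then have W: "W \<in> Obj C" "finsum (end_ring C W) (\<lambda>k. Comp C W X W (i k) (p k)) {} = Ident C W"
    by (auto simp: is_biproduct_def)
  interpret E: ring "end_ring C W" using ring_end_ring[OF W(1)] .
  have "Ident C W = HomZero C W W" using W(2) by simp
  then show ?thesis
    unfolding splits_def using X W(1)
    by (intro bexI[of _ W] bexI[of _ "HomZero C X W"] bexI[of _ "HomZero C W X"])
      (simp_all add: comp_simps)
qed

text \<open>The sum splits through the biproduct of the two objects that split \<open>e\<close> and
  \<open>f\<close>; orthogonality makes the cross terms vanish.\<close>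

lemma splits_add:
  assumes X: "X \<in> Obj C"
    and hom: "e \<in> Hom C X X" "f \<in> Hom C X X"
    and orth: "Comp C X X X e f = HomZero C X X" "Comp C X X X f e = HomZero C X X"
    and sp: "splits C X e" "splits C X f"
  shows "splits C X (HomAdd C X X e f)"
proof -
  obtain Y \<pi> \<iota> where Y: "Y \<in> Obj C" "\<pi> \<in> Hom C X Y" "\<iota> \<in> Hom C Y X"
    and e: "e = Comp C X Y X \<iota> \<pi>" and oneY: "Comp C Y X Y \<pi> \<iota> = Ident C Y"
    using sp(1) unfolding splits_def by blast
  obtain Z \<rho> \<kappa> where Z: "Z \<in> Obj C" "\<rho> \<in> Hom C X Z" "\<kappa> \<in> Hom C Z X"
    and f: "f = Comp C X Z X \<kappa> \<rho>" and oneZ: "Comp C Z X Z \<rho> \<kappa> = Ident C Z"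
    using sp(2) unfolding splits_def by blast
  define T where "T k = (if k = 0 then Y else Z)" for k :: nat
  obtain W i p where W: "is_biproduct C 2 T W i p"
    using finite_biproducts[of 2 T] Y(1) Z(1) unfolding T_def by metis
  define i0 i1 p0 p1 where "i0 = i 0" "i1 = i 1" "p0 = p 0" "p1 = p 1"
  note defs = i0_i1_p0_p1_def
  have WO: "W \<in> Obj C" and
    hW: "i0 \<in> Hom C Y W" "i1 \<in> Hom C Z W" "p0 \<in> Hom C W Y" "p1 \<in> Hom C W Z" and
    rel: "Comp C Y W Y p0 i0 = Ident C Y" "Comp C Z W Z p1 i1 = Ident C Z"
      "Comp C Z W Y p0 i1 = HomZero C Z Y" "Comp C Y W Z p1 i0 = HomZero C Y Z"
    using W by (auto simp: is_biproduct_def numeral_2_eq_2 All_less_Suc T_def defs)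
  interpret E: ring "end_ring C W" using ring_end_ring[OF WO] .
  have "finsum (end_ring C W) (\<lambda>k. Comp C W (T k) W (i k) (p k)) {..<2} = Ident C W"
    using W by (simp add: is_biproduct_def)
  moreover have "{..<2::nat} = {0, 1}" by auto
  ultimately have sum: "HomAdd C W W (Comp C W Y W i0 p0) (Comp C W Z W i1 p1) = Ident C W"
    using hW WO Y(1) Z(1) by (simp add: E.finsum_insert T_def defs comp_simps)
  note simps = X Y Z WO hW comp_simps
  \<comment> \<open>Cancelling \<rho> \<kappa> and \<pi> \<iota> in \<rho> f e \<iota> leaves \<rho>
    \<iota>, which is therefore zero together with \<open>f e\<close>.\<close>
  have "Comp C Y X Z \<rho> \<iota> = Comp C Y X Z \<rho> (Comp C Y X X (Comp C X X X f e) \<iota>)"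
    unfolding e f by (simp add: simps oneY oneZ comp_cancel[OF oneZ])
  then have cross1: "Comp C Y X Z \<rho> \<iota> = HomZero C Y Z"
    unfolding orth by (simp add: simps)
  have "Comp C Z X Y \<pi> \<kappa> = Comp C Z X Y \<pi> (Comp C Z X X (Comp C X X X e f) \<kappa>)"
    unfolding e f by (simp add: simps oneY oneZ comp_cancel[OF oneY])
  then have cross2: "Comp C Z X Y \<pi> \<kappa> = HomZero C Z Y"
    unfolding orth by (simp add: simps)
  define \<alpha> where "\<alpha> = HomAdd C X W (Comp C X Y W i0 \<pi>) (Comp C X Z W i1 \<rho>)"
  define \<beta> where "\<beta> = HomAdd C W X (Comp C W Y X \<iota> p0) (Comp C W Z X \<kappa> p1)"
  note cancel = comp_cancel[OF oneY] comp_cancel[OF oneZ] comp_cancel[OF cross1]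
    comp_cancel[OF cross2] comp_cancel[OF rel(1)] comp_cancel[OF rel(2)] comp_cancel[OF rel(3)]
    comp_cancel[OF rel(4)]
  have "\<alpha> \<in> Hom C X W" "\<beta> \<in> Hom C W X" by (simp_all add: \<alpha>_def \<beta>_def simps)
  moreover have "Comp C X W X \<beta> \<alpha> = HomAdd C X X e f"
    unfolding \<alpha>_def \<beta>_def e f by (simp add: simps cancel)
  moreover have "Comp C W X W \<alpha> \<beta> = Ident C W"
    using sum unfolding \<alpha>_def \<beta>_def by (simp add: simps cancel)
  ultimately show ?thesis
    unfolding splits_def using WO by metis
qed

section \<open>The two directions of the equivalence\<close>

text \<open>The composites \<open>i k\<close> after \<open>p k\<close> form a complete orthogonal
  system with corners isomorphic to the local rings End (Y k). The same system gives
  semi-perfectness and, since each of its members splits by construction, starts the argument of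
  \<open>idem_class_all\<close>.\<close>

lemma krull_schmidt_split_and_semi_perfect:
  assumes bi: "is_biproduct C n Y X i p" and loc: "\<forall>k<n. local_ring (end_ring C (Y k))"
  shows "semi_perfect (end_ring C X)"
    and "\<lbrakk>\<phi> \<in> Hom C X X; Comp C X X X \<phi> \<phi> = \<phi>\<rbrakk> \<Longrightarrow> splits C X \<phi>"
proof -
  have X: "X \<in> Obj C" using bi by (simp add: is_biproduct_def)
  interpret E: ring "end_ring C X" using ring_end_ring[OF X] .
  define e where "e k = Comp C X (Y k) X (i k) (p k)" for k
  have Y: "Y k \<in> Obj C" "i k \<in> Hom C (Y k) X" "p k \<in> Hom C X (Y k)"
    and rel: "Comp C (Y k) X (Y j) (p j) (i k)
        = (if j = k then Ident C (Y k) else HomZero C (Y k) (Y j))"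
    if "k < n" "j < n" for j k
    using bi that by (simp_all add: is_biproduct_def)
  have "Comp C X X X (e j) (e k) = (if j = k then e k else HomZero C X X)" if "j < n" "k < n" for j k
    using Y[OF that(1,1)] Y[OF that(2,2)] X rel[OF that(2,1)]
    by (auto simp: e_def comp_simps comp_cancel[OF rel[OF that(2,1)]])
  then have sys: "idem_system (end_ring C X) n e"
    using bi X Y unfolding idem_system_def
    by (auto simp: is_biproduct_def e_def[abs_def] comp_closed)
  have locc: "local_ring (corner (end_ring C X) (e k))" if k: "k < n" for k
  proof -
    have "Comp C (Y k) X (Y k) (p k) (i k) = Ident C (Y k)" using rel[OF k k] by simp
    then show ?thesis
      unfolding e_def using local_ring_corner_end_ring_iff[OF X Y[OF k k]] loc k by blast
  qed
  show "semi_perfect (end_ring C X)"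
    using E.semi_perfect_iff sys locc by blast
  assume \<phi>: "\<phi> \<in> Hom C X X" "Comp C X X X \<phi> \<phi> = \<phi>"
  have se: "splits C X (e k)" if "k < n" for k
    unfolding splits_def e_def using Y[OF that that] rel[OF that that] by auto
  show "splits C X \<phi>"
  proof (rule E.idem_class_all[where S = "splits C X", OF sys locc])
    show "splits C X \<zero>\<^bsub>end_ring C X\<^esub>" using splits_zero[OF X] by simp
  qed (simp_all add: \<phi> se splits_swap[OF X] splits_add[OF X])
qed

text \<open>Splitting each idempotent of a system with local corners through an object
  \<open>Y k\<close> turns the system into a biproduct decomposition of \<open>X\<close>.\<close>

lemma local_decomposition_of_semi_perfect:
  assumes split: "split_idempotents C" and X: "X \<in> Obj C" and sp: "semi_perfect (end_ring C X)"
  shows "\<exists>n Y i p. is_biproduct C n Y X i p \<and> (\<forall>k<n. local_ring (end_ring C (Y k)))"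
proof -
  interpret E: ring "end_ring C X" using ring_end_ring[OF X] .
  obtain n e where sys: "idem_system (end_ring C X) n e"
    and loc: "\<forall>k<n. local_ring (corner (end_ring C X) (e k))"
    using sp E.semi_perfect_iff by blast
  have e: "e k \<in> Hom C X X" "Comp C X X X (e j) (e k) = (if j = k then e k else HomZero C X X)"
    if "k < n" "j < n" for j k
    using sys that by (auto simp: idem_system_def)
  have "\<exists>Y p i. Y \<in> Obj C \<and> p \<in> Hom C X Y \<and> i \<in> Hom C Y X \<and>
      e k = Comp C X Y X i p \<and> Comp C Y X Y p i = Ident C Y" if k: "k < n" for k
  proof -
    have "e k \<in> Hom C X X" "Comp C X X X (e k) (e k) = e k" using e[OF k k] by simp_all
    then obtain Y p i where "Y \<in> Obj C" "p \<in> Hom C X Y" "i \<in> Hom C Y X"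
      "e k = Comp C X Y X i p" "Comp C Y X Y p i = Ident C Y"
      using split X unfolding split_idempotents_def by meson
    then show ?thesis by blast
  qed
  \<comment> \<open>The bound on \<open>k\<close> moves under the existential quantifiers so that
    choice yields total functions, with arbitrary values from \<open>n\<close> on.\<close>
  then have "\<forall>k. \<exists>Y p i. k < n \<longrightarrow> Y \<in> Obj C \<and> p \<in> Hom C X Y \<and> i \<in> Hom C Y X \<and>
      e k = Comp C X Y X i p \<and> Comp C Y X Y p i = Ident C Y"
    by meson
  then obtain Y p i where "\<forall>k. k < n \<longrightarrow> Y k \<in> Obj C \<and> p k \<in> Hom C X (Y k) \<and>
      i k \<in> Hom C (Y k) X \<and> e k = Comp C X (Y k) X (i k) (p k) \<and>
      Comp C (Y k) X (Y k) (p k) (i k) = Ident C (Y k)"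
    by (simp only: choice_iff) (elim exE, rule that)
  then have Y: "Y k \<in> Obj C" "p k \<in> Hom C X (Y k)" "i k \<in> Hom C (Y k) X"
    and ek: "e k = Comp C X (Y k) X (i k) (p k)"
    and one: "Comp C (Y k) X (Y k) (p k) (i k) = Ident C (Y k)"
    if "k < n" for k
    using that by blast+
  have "Comp C (Y k) X (Y j) (p j) (i k) = HomZero C (Y k) (Y j)" if "j < n" "k < n" "j \<noteq> k" for j k
  proof -
    note simps = X Y[OF that(1)] Y[OF that(2)] comp_simps one[OF that(1)] one[OF that(2)]
      comp_cancel[OF one[OF that(1)]] comp_cancel[OF one[OF that(2)]]
    \<comment> \<open>Inserting \<open>e j e k\<close> between \<open>p j\<close> and
      \<open>i k\<close> changes nothing, because \<open>p j\<close> absorbs \<open>e j\<close> and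
      \<open>i k\<close> absorbs \<open>e k\<close>; orthogonality then makes the composite
      zero.\<close>
    have "Comp C (Y k) X (Y j) (p j) (i k)
        = Comp C (Y k) X (Y j) (p j) (Comp C (Y k) X X (Comp C X X X (e j) (e k)) (i k))"
      unfolding ek[OF that(1)] ek[OF that(2)] by (simp add: simps)
    also have "\<dots> = HomZero C (Y k) (Y j)"
      using e(2)[OF that(2,1)] that(3) by (simp add: simps)
    finally show ?thesis .
  qed
  moreover have "finsum (end_ring C X) (\<lambda>k. Comp C X (Y k) X (i k) (p k)) {..<n} = Ident C X"
  proof -
    have "finsum (end_ring C X) (\<lambda>k. Comp C X (Y k) X (i k) (p k)) {..<n} = finsum (end_ring C X) e {..<n}"
      using e ek by (intro E.finsum_cong') auto
    then show ?thesis using sys by (simp add: idem_system_def)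
  qed
  ultimately have "is_biproduct C n Y X i p"
    using X Y one unfolding is_biproduct_def by auto
  moreover have "local_ring (end_ring C (Y k))" if "k < n" for k
    using loc that local_ring_corner_end_ring_iff[OF X Y(1,3,2)[OF that] one[OF that]] ek[OF that]
    by metis
  ultimately show ?thesis by blast
qed

end

theorem corollary4p4:
  fixes C :: "('o, 'm) preadd_cat"
  assumes "additive_category C"
  shows "krull_schmidt C \<longleftrightarrow>
    split_idempotents C \<and> (\<forall>A \<in> Obj C. semi_perfect (end_ring C A))"
proof -
  interpret additive_category C by fact
  show ?thesis
  proof
    assume ks: "krull_schmidt C"
    \<comment> \<open>A decomposition of \<open>X\<close> alone yields both properties at
      \<open>X\<close>.\<close>
    have "semi_perfect (end_ring C X) \<and>
        (\<forall>\<phi> \<in> Hom C X X. Comp C X X X \<phi> \<phi> = \<phi> \<longrightarrow> splits C X \<phi>)" if X: "X \<in> Obj C" for X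
    proof -
      have "\<exists>n Y i p. is_biproduct C n Y X i p \<and> (\<forall>k<n. local_ring (end_ring C (Y k)))"
        using ks X unfolding krull_schmidt_def by (elim conjE bspec)
      then obtain n Y i p where bi: "is_biproduct C n Y X i p" "\<forall>k<n. local_ring (end_ring C (Y k))"
        by (elim exE conjE) (rule that)
      show ?thesis
        by (intro conjI ballI impI krull_schmidt_split_and_semi_perfect[OF bi])
    qed
    then show "split_idempotents C \<and> (\<forall>A \<in> Obj C. semi_perfect (end_ring C A))"
      unfolding split_idempotents_def splits_def[symmetric] by blast
  next
    assume asm: "split_idempotents C \<and> (\<forall>A \<in> Obj C. semi_perfect (end_ring C A))"
    show "krull_schmidt C"
      unfolding krull_schmidt_def
    proof (intro conjI ballI assms)
      fix X assume X: "X \<in> Obj C"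
      show "\<exists>n Y i p. is_biproduct C n Y X i p \<and> (\<forall>k<n. local_ring (end_ring C (Y k)))"
        using asm X by (intro local_decomposition_of_semi_perfect) blast+
    qed
  qed
qed

end
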